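(* Let $n,p$ be integers with $p\ge 2$ and $n \geq p+2$, and let $T_1,T_2$ be two tournaments with vertex set $[n]$. There exists a family $X_1, \dots, X_\ell \subseteq [n]$ of subsets each of size exactly $p$ such that $T_2 = \mathrm{Inv}(T_1; X_1, \dots, X_\ell)$ if and only if one of the following occurs: (1) $p \equiv 0 \pmod 4$ and $|F(T_1)| \equiv |F(T_2)| \pmod 2$; (2) $p \equiv 1 \pmod 4$, $|F(T_1,i)| \equiv |F(T_2,i)| \pmod 2$ for every $i \in [n-1]$, and $|F(T_1)| \equiv |F(T_2)| \pmod 2$; (3) $p \equiv 2 \pmod 4$; (4) $p \equiv 3 \pmod 4$ and $|F(T_1,i)| \equiv |F(T_2,i)| \pmod 2$ for every $i \in [n-1]$.
   Context: For an oriented graph $D$ and $X\subseteq V(D)$, the inversion of $X$ reverses the orientation of every arc with both endpoints in $X$; $\mathrm{Inv}(D;X_1,\dots,X_\ell)$ denotes the oriented graph obtained by inverting $X_1,\dots,X_\ell$ one after another (equivalently, reversing exactly the arcs whose two endpoints lie together in an odd number of the $X_j$). For a tournament $T$ on $[n]$, an arc $ij$ is forward if $i<j$; $F(T)$ is the set of forward arcs of $T$, and $F(T,i)$ is the set of forward arcs of $T$ incident with vertex $i$. *)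

theory Defs
  imports "Graph_Theory.Pair_Digraph" "HOL-Number_Theory.Cong"
begin

locale oriented_graph = pair_digraph +
  assumes no_opposite_arcs: "(u, v) \<in> parcs G \<Longrightarrow> (v, u) \<notin> parcs G"

locale tournament = oriented_graph +
  assumes arc_between:
    "\<lbrakk>u \<in> pverts G; v \<in> pverts G; u \<noteq> v\<rbrakk> \<Longrightarrow> (u, v) \<in> parcs G \<or> (v, u) \<in> parcs G"

definition inversion :: "'a pair_pre_digraph \<Rightarrow> 'a set \<Rightarrow> 'a pair_pre_digraph" where
  "inversion D X = D\<lparr>parcs :=
     {(u, v). (u, v) \<in> parcs D \<and> \<not> (u \<in> X \<and> v \<in> X)} \<union>
     {(v, u) | u v. (u, v) \<in> parcs D \<and> u \<in> X \<and> v \<in> X}\<rparr>"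

definition Inv :: "'a pair_pre_digraph \<Rightarrow> 'a set list \<Rightarrow> 'a pair_pre_digraph" where
  "Inv D Xs = foldl inversion D Xs"

definition forward_arcs :: "nat pair_pre_digraph \<Rightarrow> (nat \<times> nat) set" where
  "forward_arcs T = {(i, j). (i, j) \<in> parcs T \<and> i < j}"

definition forward_arcs_at :: "nat pair_pre_digraph \<Rightarrow> nat \<Rightarrow> (nat \<times> nat) set" where
  "forward_arcs_at T i = {e \<in> forward_arcs T. fst e = i \<or> snd e = i}"

lemma pverts_inversion [simp]: "pverts (inversion D X) = pverts D"
  by (simp add: inversion_def)

lemma in_parcs_inversion_iff:
  "(u, v) \<in> parcs (inversion D X) \<longleftrightarrow>
     (if u \<in> X \<and> v \<in> X then (v, u) \<in> parcs D else (u, v) \<in> parcs D)"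
  by (auto simp: inversion_def)

lemma pverts_Inv [simp]: "pverts (Inv D Xs) = pverts D"
  unfolding Inv_def by (induction Xs arbitrary: D) simp_all

lemma in_parcs_Inv_iff:
  "(u, v) \<in> parcs (Inv D Xs) \<longleftrightarrow>
     (if odd (length (filter (\<lambda>X. u \<in> X \<and> v \<in> X) Xs))
      then (v, u) \<in> parcs D else (u, v) \<in> parcs D)"
  unfolding Inv_def
  by (induction Xs arbitrary: D) (auto simp: in_parcs_inversion_iff)

end

theory Submission
  imports Defs
begin

text \<open>
  Encode a tournament on \<open>[n]\<close> by the edge set of its forward arcs; inverting \<open>X\<close> adds the
  complete graph on \<open>X\<close> over \<open>\<bbbF>\<^sub>2\<close>. So the question is which graphs lie in the span \<open>S\<close> of the
  complete graphs on \<open>p\<close> vertices. Degrees and edge counts of these graphs give necessity.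
  Conversely, exchanging one vertex of a \<open>p\<close>-clique for another shows that \<open>S\<close> contains every
  \<open>K\<^bsub>{a,b},A\<^esub>\<close> with \<open>|A| = p - 1\<close>, and exchanging a vertex of \<open>A\<close> (here \<open>n \<ge> p + 2\<close> is used)
  gives all 4-cycles. If \<open>p\<close> is even, \<open>S\<close> then contains all paths with two edges, so all edges are
  congruent modulo \<open>S\<close>. If \<open>p\<close> is odd, all triangles are congruent modulo \<open>S\<close>, and every graph
  with even degrees is a sum of triangles through a fixed vertex. In both cases only the parity
  of the number of edges remains to be compared with that of the \<open>p\<close>-clique.
\<close>

section \<open>Spans over the two-element field\<close>

text \<open>Linear span over the two-element field: a set stands for its indicator vector and
  \<open>sym_diff\<close> is addition. Generators are added one at a time, which matches performing
  one inversion at a time.\<close>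

inductive_set xor_span :: "'a set set \<Rightarrow> 'a set set" for G where
  empty: "{} \<in> xor_span G"
| step: "\<lbrakk>g \<in> G; E \<in> xor_span G\<rbrakk> \<Longrightarrow> sym_diff g E \<in> xor_span G"

lemma sym_diff_assoc: "sym_diff (sym_diff A B) C = sym_diff A (sym_diff B C)"
  by blast

lemma sym_diff_cancel_middle: "sym_diff (sym_diff A B) (sym_diff B C) = sym_diff A C"
  by blast

lemma xor_span_base: "g \<in> G \<Longrightarrow> g \<in> xor_span G"
  using xor_span.step[OF _ xor_span.empty, of g G] by simp

lemma xor_span_sym_diff:
  assumes "A \<in> xor_span G" "B \<in> xor_span G"
  shows "sym_diff A B \<in> xor_span G"
  using assms(1)
proof induction
  case empty
  then show ?case using assms(2) by simp
next
  case (step g E)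
  show ?case
    unfolding sym_diff_assoc by (rule xor_span.step[OF step.hyps(1) step.IH])
qed

text \<open>Membership of \<open>sym_diff A B\<close> in the span is congruence of \<open>A\<close>
  and \<open>B\<close> modulo the span; this is its transitivity.\<close>

lemma xor_span_sym_diff_trans:
  assumes "sym_diff A B \<in> xor_span G" "sym_diff B C \<in> xor_span G"
  shows "sym_diff A C \<in> xor_span G"
  using xor_span_sym_diff[OF assms] unfolding sym_diff_cancel_middle .

section \<open>Parity of sizes and two induction principles for finite sets\<close>

text \<open>The sizes of \<open>A\<close> and \<open>B\<close> add up to that of
  \<open>sym_diff A B\<close> plus twice that of \<open>A \<inter> B\<close>. So size parity is
  additive, which makes edge counts and degrees usable as invariants.\<close>

lemma even_card_sym_diff:
  assumes "finite A" "finite B"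
  shows "even (card (sym_diff A B)) \<longleftrightarrow> (even (card A) \<longleftrightarrow> even (card B))"
proof -
  have "card (sym_diff A B) = card (A - B) + card (B - A)"
    using assms by (intro card_Un_disjoint) auto
  moreover have "card A = card (A - B) + card (A \<inter> B)"
    using assms by (subst card_Un_disjoint[symmetric]) (auto intro: arg_cong[where f = card])
  moreover have "card B = card (B - A) + card (A \<inter> B)"
    using assms by (subst card_Un_disjoint[symmetric]) (auto intro: arg_cong[where f = card])
  ultimately show ?thesis by auto
qed

text \<open>While \<open>X\<close> differs from \<open>Y\<close>, equal sizes provide
  \<open>x\<close> in \<open>X - Y\<close> and \<open>y\<close> in \<open>Y - X\<close>; replacing
  \<open>x\<close> by \<open>y\<close> shrinks \<open>X - Y\<close>.\<close>

lemma card_eq_exchange_induct: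
  assumes X: "finite X" "X \<subseteq> V" "card X = Suc k" and Y: "finite Y" "Y \<subseteq> V" "card Y = Suc k"
    and refl: "P Y"
    and exch: "\<And>x y B. \<lbrakk>x \<in> V; y \<in> V; x \<noteq> y; x \<notin> B; y \<notin> B; B \<subseteq> V; finite B; card B = k;
                 P (insert y B)\<rbrakk> \<Longrightarrow> P (insert x B)"
  shows "P X"
  using X
proof (induction "card (X - Y)" arbitrary: X)
  case 0
  then have "X \<subseteq> Y" by auto
  then have "X = Y" using 0 Y by (simp add: card_subset_eq)
  then show ?case using refl by simp
next
  case (Suc m)
  then have "X - Y \<noteq> {}" by force
  then obtain x where x: "x \<in> X" "x \<notin> Y" by auto
  have "\<not> Y \<subseteq> X"
    using x Suc.prems Y by (metis card_subset_eq)
  then obtain y where y: "y \<in> Y" "y \<notin> X" by auto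
  let ?B = "X - {x}"
  have "insert y ?B - Y = (X - Y) - {x}" using y by auto
  then have "card (insert y ?B - Y) = m"
    using Suc.hyps(2) x by simp
  moreover have "card (insert y ?B) = Suc k"
    using Suc.prems x y by simp
  ultimately have "P (insert y ?B)"
    using Suc.prems x y Y by (intro Suc.hyps(1)) auto
  then have "P (insert x ?B)"
    using Suc.prems x y Y by (intro exch[of x y]) auto
  then show ?case using x by (simp add: insert_absorb)
qed

lemma finite_even_card_induct [consumes 2, case_names empty insert2]:
  assumes "finite A" "even (card A)"
    and empty: "P {}"
    and insert2: "\<And>x y A. \<lbrakk>finite A; x \<noteq> y; x \<notin> A; y \<notin> A; P A\<rbrakk> \<Longrightarrow> P (insert x (insert y A))"
  shows "P A"
  using assms(1,2)
proof (induction "card A" arbitrary: A rule: less_induct)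
  case less
  show ?case
  proof (cases "A = {}")
    case True
    then show ?thesis using empty by simp
  next
    case False
    then obtain x where x: "x \<in> A" by auto
    have "A - {x} \<noteq> {}"
    proof
      assume "A - {x} = {}"
      then have "A = {x}" using x by auto
      then show False using less.prems by simp
    qed
    then obtain y where y: "y \<in> A" "y \<noteq> x" by auto
    let ?B = "A - {x} - {y}"
    have A: "A = insert x (insert y ?B)" using x y by auto
    have "card A = Suc (Suc (card ?B))"
      using x y less.prems(1) by (metis DiffI card_Suc_Diff1 empty_iff finite_Diff insert_iff)
    then have "P ?B" using less.prems by (intro less.hyps) auto
    then have "P (insert x (insert y ?B))"
      using less.prems y by (intro insert2) auto
    then show ?thesis using A by simp
  qed
qed

section \<open>Complete graphs\<close>

definition clique :: "'a set \<Rightarrow> 'a set set" where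
  "clique X = {e. e \<subseteq> X \<and> card e = 2}"

text \<open>For \<open>a\<close>, \<open>b\<close> distinct and outside \<open>A\<close> this is the
  complete bipartite graph with sides \<open>{a, b}\<close> and \<open>A\<close>: a path with two
  edges if \<open>A\<close> is a singleton, a 4-cycle if \<open>A\<close> has two elements.\<close>

definition biclique2 :: "'a \<Rightarrow> 'a \<Rightarrow> 'a set \<Rightarrow> 'a set set" where
  "biclique2 a b A = (\<lambda>y. {a, y}) ` A \<union> (\<lambda>y. {b, y}) ` A"

lemma clique_alt: "clique X = {{u, v} | u v. u \<in> X \<and> v \<in> X \<and> u \<noteq> v}"
  unfolding clique_def by (auto simp: card_2_iff)

text \<open>Lets a single edge be treated as a 2-clique, so that one exchange argument covers both
  edges and triangles.\<close>

lemma clique_edge: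
  assumes "card e = 2"
  shows "clique e = {e}"
proof -
  have "finite e" using assms by (intro card_ge_0_finite) simp
  then have "x = e" if "x \<subseteq> e" "card x = 2" for x
    using that assms by (simp add: card_subset_eq)
  then show ?thesis using assms by (auto simp: clique_def)
qed

lemma clique_mono: "X \<subseteq> Y \<Longrightarrow> clique X \<subseteq> clique Y"
  unfolding clique_def by auto

lemma finite_clique: "finite X \<Longrightarrow> finite (clique X)"
  unfolding clique_def by simp

lemma card_clique: "finite X \<Longrightarrow> card (clique X) = card X choose 2"
  unfolding clique_def by (rule n_subsets)

lemma card_clique_at:
  assumes "finite X" "i \<in> X"
  shows "card {e \<in> clique X. i \<in> e} = card X - 1"
proof -
  have "{e \<in> clique X. i \<in> e} = (\<lambda>y. {i, y}) ` (X - {i})"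
    using assms by (auto simp: clique_alt insert_commute)
  moreover have "inj_on (\<lambda>y. {i, y}) (X - {i})"
    by (auto simp: inj_on_def doubleton_eq_iff)
  ultimately show ?thesis using assms by (simp add: card_image)
qed

text \<open>Degrees are \<open>card X - 1\<close> on \<open>X\<close> and 0 elsewhere.\<close>

lemma even_card_clique_at:
  assumes "finite X" "odd (card X)"
  shows "even (card {e \<in> clique X. i \<in> e})"
proof (cases "i \<in> X")
  case True
  then show ?thesis using assms by (simp add: card_clique_at)
next
  case False
  then have none: "{e \<in> clique X. i \<in> e} = {}" by (auto simp: clique_def)
  show ?thesis unfolding none by simp
qed

text \<open>Twice the binomial is \<open>p * (p - 1)\<close>, a product of coprime factors, so 4
  divides it exactly when 4 divides one of them. The residue classes of the main theorem enter
  here.\<close>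

lemma even_choose_two: "even (p choose 2) \<longleftrightarrow> p mod 4 = 0 \<or> p mod 4 = 1"
proof -
  define q where "q = p div 4"
  have p: "p = 4 * q + p mod 4" by (simp add: q_def)
  have "p mod 4 < 4" by simp
  then consider "p mod 4 = 0" | "p mod 4 = 1" | "p mod 4 = 2" | "p mod 4 = 3" by linarith
  then show ?thesis
  proof cases
    case 1
    then have "p choose 2 = 2 * (q * (4 * q - 1))" using p by (simp add: choose_two)
    then show ?thesis using 1 by simp
  next
    case 2
    then have "p choose 2 = (4 * q + 1) * (4 * q) div 2" using p by (simp add: choose_two)
    also have "\<dots> = 2 * ((4 * q + 1) * q)" by simp
    finally show ?thesis using 2 by simp
  next
    case 3
    then have "p choose 2 = (4 * q + 2) * (4 * q + 1) div 2" using p by (simp add: choose_two)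
    also have "(4 * q + 2) * (4 * q + 1) = 2 * ((2 * q + 1) * (4 * q + 1))" by simp
    finally show ?thesis using 3 by simp
  next
    case 4
    then have "p choose 2 = (4 * q + 3) * (4 * q + 2) div 2" using p by (simp add: choose_two)
    also have "(4 * q + 3) * (4 * q + 2) = 2 * ((4 * q + 3) * (2 * q + 1))" by simp
    finally show ?thesis using 4 by simp
  qed
qed

lemma clique_insert:
  assumes "a \<notin> A"
  shows "clique (insert a A) = clique A \<union> (\<lambda>y. {a, y}) ` A"
proof (intro equalityI subsetI)
  fix e assume "e \<in> clique (insert a A)"
  then obtain u v where "e = {u, v}" "u \<noteq> v" "u \<in> insert a A" "v \<in> insert a A"
    unfolding clique_alt by blast
  then show "e \<in> clique A \<union> (\<lambda>y. {a, y}) ` A"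
    unfolding clique_alt by (cases "u = a"; cases "v = a") (auto simp: insert_commute)
next
  fix e assume e: "e \<in> clique A \<union> (\<lambda>y. {a, y}) ` A"
  have "{a, y} \<in> clique (insert a A)" if "y \<in> A" for y
    using that assms by (cases "a = y") (auto simp: clique_def)
  then show "e \<in> clique (insert a A)"
    using e clique_mono[of A "insert a A"] by blast
qed

text \<open>Edges inside \<open>A\<close> cancel, and the edge \<open>{a, b}\<close> lies in neither
  clique; only the stars from \<open>a\<close> and \<open>b\<close> to \<open>A\<close>
  survive.\<close>

lemma sym_diff_clique_insert:
  assumes "a \<noteq> b" "a \<notin> A" "b \<notin> A"
  shows "sym_diff (clique (insert a A)) (clique (insert b A)) = biclique2 a b A"
proof -
  have "clique A \<inter> biclique2 a b A = {}"
    using assms by (auto simp: biclique2_def clique_def)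
  moreover have "(\<lambda>y. {a, y}) ` A \<inter> (\<lambda>y. {b, y}) ` A = {}"
    using assms by (auto simp: doubleton_eq_iff)
  moreover have "sym_diff (C \<union> P) (C \<union> Q) = P \<union> Q"
    if "C \<inter> (P \<union> Q) = {}" "P \<inter> Q = {}" for C P Q :: "'a set set"
    using that by blast
  ultimately show ?thesis
    unfolding clique_insert[OF assms(2)] clique_insert[OF assms(3)] biclique2_def by simp
qed

text \<open>For fixed \<open>a\<close> and \<open>b\<close>, the biclique is additive in its other
  side: the two stars never meet, and each is an injective image.\<close>

lemma sym_diff_biclique2:
  assumes "a \<noteq> b" "a \<notin> A" "b \<notin> A" "a \<notin> B" "b \<notin> B"
  shows "sym_diff (biclique2 a b A) (biclique2 a b B) = biclique2 a b (sym_diff A B)"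
proof -
  have inj: "inj (\<lambda>y. {x, y})" for x :: 'a
    by (auto simp: inj_def doubleton_eq_iff)
  have img: "(\<lambda>y. {x, y}) ` (sym_diff A B) = sym_diff ((\<lambda>y. {x, y}) ` A) ((\<lambda>y. {x, y}) ` B)" for x
    by (simp add: image_Un image_set_diff[OF inj])
  have "((\<lambda>y. {a, y}) ` A \<union> (\<lambda>y. {a, y}) ` B) \<inter> ((\<lambda>y. {b, y}) ` A \<union> (\<lambda>y. {b, y}) ` B) = {}"
    using assms by (auto simp: doubleton_eq_iff)
  moreover have "sym_diff (P \<union> Q) (P' \<union> Q') = sym_diff P P' \<union> sym_diff Q Q'"
    if "(P \<union> P') \<inter> (Q \<union> Q') = {}" for P P' Q Q' :: "'a set set"
    using that by blast
  ultimately show ?thesis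
    unfolding biclique2_def img by simp
qed

section \<open>The span of the cliques of a given size\<close>

locale clique_span =
  fixes V :: "'a set" and p :: nat
  assumes finite_V: "finite V" and p_ge_2: "p \<ge> 2" and card_V: "card V \<ge> p + 2"
begin

definition S :: "'a set set set" where
  "S = xor_span (clique ` {X. X \<subseteq> V \<and> card X = p})"

lemma empty_in_S: "{} \<in> S"
  unfolding S_def by (rule xor_span.empty)

lemma clique_in_S: "\<lbrakk>X \<subseteq> V; card X = p\<rbrakk> \<Longrightarrow> clique X \<in> S"
  unfolding S_def by (auto intro: xor_span_base)

lemma sym_diff_in_S: "\<lbrakk>A \<in> S; B \<in> S\<rbrakk> \<Longrightarrow> sym_diff A B \<in> S"
  unfolding S_def by (rule xor_span_sym_diff)

lemma sym_diff_trans_S: "\<lbrakk>sym_diff A B \<in> S; sym_diff B C \<in> S\<rbrakk> \<Longrightarrow> sym_diff A C \<in> S"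
  unfolding S_def by (rule xor_span_sym_diff_trans)

text \<open>Supplies auxiliary vertices: \<open>A\<close> is prescribed and \<open>W\<close> is to
  be avoided.\<close>

lemma ex_superset_card:
  assumes "A \<subseteq> V - W" "card A \<le> k" "W \<subseteq> V" "k + card W \<le> card V"
  shows "\<exists>B. A \<subseteq> B \<and> B \<subseteq> V - W \<and> card B = k"
proof -
  have "card (V - W) = card V - card W"
    using assms finite_V by (simp add: card_Diff_subset finite_subset)
  then have "k \<le> card (V - W)" using assms by simp
  then show ?thesis
    using exists_subset_between[of A k "V - W"] assms(1,2) finite_V by auto
qed

section \<open>Bicliques in \<open>S\<close> and congruences between small cliques\<close>

lemma biclique2_in_S_pred:
  assumes "a \<in> V" "b \<in> V" "a \<noteq> b" "A \<subseteq> V - {a, b}" "Suc (card A) = p"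
  shows "biclique2 a b A \<in> S"
proof -
  have fin: "finite A" using assms finite_V finite_subset by blast
  have "a \<notin> A" "b \<notin> A" using assms by auto
  then have "card (insert a A) = p" "card (insert b A) = p"
    using assms(5) fin by simp_all
  moreover have "insert a A \<subseteq> V" "insert b A \<subseteq> V"
    using assms(1,2,4) by auto
  ultimately have "clique (insert a A) \<in> S" "clique (insert b A) \<in> S"
    by (simp_all only: clique_in_S)
  then have "sym_diff (clique (insert a A)) (clique (insert b A)) \<in> S"
    by (rule sym_diff_in_S)
  then show ?thesis
    using sym_diff_clique_insert[OF \<open>a \<noteq> b\<close> \<open>a \<notin> A\<close> \<open>b \<notin> A\<close>] by simp
qed

lemma four_cycle_in_S:
  assumes "a \<in> V" "b \<in> V" "a \<noteq> b" "c \<in> V - {a, b}" "d \<in> V - {a, b}" "c \<noteq> d"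
  shows "biclique2 a b {c, d} \<in> S"
proof -
  have "card {a, b, c, d} = 4" using assms by auto
  then obtain B where B: "B \<subseteq> V - {a, b, c, d}" "card B = p - 2"
    \<comment> \<open>Four vertices are avoided and \<open>p - 2\<close> more are chosen, so exactly
      \<open>p + 2\<close> vertices are required.\<close>
    using ex_superset_card[of "{}" "{a, b, c, d}" "p - 2"] assms card_V p_ge_2 by auto
  have fin: "finite B" using B finite_V finite_subset by blast
  have notin: "c \<notin> B" "d \<notin> B" using B by auto
  have "biclique2 a b (insert c B) \<in> S" "biclique2 a b (insert d B) \<in> S"
    using assms B fin notin p_ge_2 by (auto intro!: biclique2_in_S_pred)
  then have "sym_diff (biclique2 a b (insert c B)) (biclique2 a b (insert d B)) \<in> S"
    by (rule sym_diff_in_S)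
  also have "sym_diff (biclique2 a b (insert c B)) (biclique2 a b (insert d B))
      = biclique2 a b (sym_diff (insert c B) (insert d B))"
    using assms B by (intro sym_diff_biclique2) auto
  also have "sym_diff (insert c B) (insert d B) = {c, d}"
    using assms notin by auto
  finally show ?thesis .
qed

text \<open>Split \<open>A\<close> into pairs; each pair contributes a 4-cycle through
  \<open>a\<close> and \<open>b\<close>. This works for every parity of \<open>p\<close>.\<close>

lemma biclique2_in_S_even:
  assumes ab: "a \<in> V" "b \<in> V" "a \<noteq> b" and A: "A \<subseteq> V - {a, b}" "even (card A)"
  shows "biclique2 a b A \<in> S"
proof -
  have "finite A" using A finite_V finite_subset by blast
  then show ?thesis using A(2,1)
  proof (induction rule: finite_even_card_induct)
    case empty
    then show ?case using empty_in_S by (simp add: biclique2_def)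
  next
    case (insert2 x y A)
    have "sym_diff (biclique2 a b {x, y}) (biclique2 a b A) \<in> S"
      using insert2 ab by (intro sym_diff_in_S four_cycle_in_S) auto
    also have "sym_diff (biclique2 a b {x, y}) (biclique2 a b A)
        = biclique2 a b (sym_diff {x, y} A)"
      using insert2 ab by (intro sym_diff_biclique2) auto
    also have "sym_diff {x, y} A = insert x (insert y A)"
      using insert2 by auto
    finally show ?case .
  qed
qed

text \<open>A biclique with \<open>p - 1\<close> vertices opposite \<open>a\<close>,
  \<open>b\<close> lies in \<open>S\<close>. For even \<open>p\<close>, so does the one with
  \<open>c\<close> removed, as \<open>p - 2\<close> is even. Their difference is the path through
  \<open>c\<close>.\<close>

lemma path_in_S:
  assumes "even p" and ab: "a \<in> V" "b \<in> V" "a \<noteq> b" and c: "c \<in> V - {a, b}"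
  shows "biclique2 a b {c} \<in> S"
proof -
  obtain A where A: "{c} \<subseteq> A" "A \<subseteq> V - {a, b}" "card A = p - 1"
    using ex_superset_card[of "{c}" "{a, b}" "p - 1"] ab c card_V p_ge_2 by fastforce
  have "biclique2 a b A \<in> S"
    using ab A p_ge_2 by (intro biclique2_in_S_pred) auto
  moreover have "card (A - {c}) = p - 2" using A by simp
  then have "biclique2 a b (A - {c}) \<in> S"
    using ab A \<open>even p\<close> p_ge_2 by (intro biclique2_in_S_even) auto
  ultimately have "sym_diff (biclique2 a b A) (biclique2 a b (A - {c})) \<in> S"
    by (rule sym_diff_in_S)
  also have "sym_diff (biclique2 a b A) (biclique2 a b (A - {c}))
      = biclique2 a b (sym_diff A (A - {c}))"
    using ab A by (intro sym_diff_biclique2) auto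
  also have "sym_diff A (A - {c}) = {c}" using A by auto
  finally show ?thesis .
qed

text \<open>Exchanging one vertex changes a clique by a biclique over the \<open>k\<close> common
  vertices. It is applied with \<open>k = 2\<close> for triangles and \<open>k = 1\<close> for
  edges.\<close>

lemma cliques_congruent:
  assumes bic: "\<And>a b A. \<lbrakk>a \<in> V; b \<in> V; a \<noteq> b; A \<subseteq> V - {a, b}; card A = k\<rbrakk> \<Longrightarrow> biclique2 a b A \<in> S"
    and X: "X \<subseteq> V" "card X = Suc k" and Y: "Y \<subseteq> V" "card Y = Suc k"
  shows "sym_diff (clique X) (clique Y) \<in> S"
proof (rule card_eq_exchange_induct[of X V k Y])
  show "sym_diff (clique Y) (clique Y) \<in> S" using empty_in_S by simp
next
  fix x y B
  assume B: "x \<in> V" "y \<in> V" "x \<noteq> y" "x \<notin> B" "y \<notin> B" "B \<subseteq> V" "card B = k"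
    and y: "sym_diff (clique (insert y B)) (clique Y) \<in> S"
  have "biclique2 x y B \<in> S" using B by (intro bic) auto
  then have "sym_diff (clique (insert x B)) (clique (insert y B)) \<in> S"
    using sym_diff_clique_insert[of x y B] B by simp
  then show "sym_diff (clique (insert x B)) (clique Y) \<in> S"
    using y by (rule sym_diff_trans_S)
qed (fact X Y finite_subset[OF X(1) finite_V] finite_subset[OF Y(1) finite_V])+

lemma triangles_congruent:
  assumes "X \<subseteq> V" "card X = 3" "Y \<subseteq> V" "card Y = 3"
  shows "sym_diff (clique X) (clique Y) \<in> S"
proof (rule cliques_congruent[of 2])
  fix a b A assume "a \<in> V" "b \<in> V" "a \<noteq> b" "A \<subseteq> V - {a, b}" "card A = 2"
  then show "biclique2 a b A \<in> S" by (intro biclique2_in_S_even) simp_all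
qed (use assms in simp_all)

lemma edges_congruent:
  assumes "even p" "e \<in> clique V" "f \<in> clique V"
  shows "sym_diff {e} {f} \<in> S"
proof -
  have "sym_diff (clique e) (clique f) \<in> S"
  proof (rule cliques_congruent[of 1])
    fix a b A assume "a \<in> V" "b \<in> V" "a \<noteq> b" "A \<subseteq> V - {a, b}" "card A = 1"
    then show "biclique2 a b A \<in> S"
      using path_in_S[OF \<open>even p\<close>] by (auto simp: card_1_singleton_iff)
  qed (use assms in \<open>auto simp: clique_def\<close>)
  moreover have "clique e = {e}" "clique f = {f}"
    using assms(2,3) by (simp_all add: clique_edge clique_def[of V])
  ultimately show ?thesis by simp
qed

text \<open>Edges are removed in pairs, and the two edges of a pair cancel modulo
  \<open>S\<close>.\<close>

lemma even_size_in_S: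
  assumes "even p" and E: "E \<subseteq> clique V" "even (card E)"
  shows "E \<in> S"
proof -
  have "finite E" using E finite_clique[OF finite_V] finite_subset by blast
  then show ?thesis using E(2,1)
  proof (induction rule: finite_even_card_induct)
    case empty
    then show ?case using empty_in_S by simp
  next
    case (insert2 e f E)
    have "sym_diff (sym_diff {e} {f}) E \<in> S"
      using insert2 \<open>even p\<close> by (intro sym_diff_in_S edges_congruent) auto
    also have "sym_diff (sym_diff {e} {f}) E = insert e (insert f E)"
      using insert2 by auto
    finally show ?case .
  qed
qed

section \<open>Graphs with all degrees even\<close>

text \<open>Membership in the cycle space. The quantifier ranges over the whole type; for a graph on
  \<open>V\<close>, vertices outside \<open>V\<close> have degree 0.\<close>

definition even_degrees :: "'a set set \<Rightarrow> bool" where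
  "even_degrees E \<longleftrightarrow> (\<forall>i. even (card {e \<in> E. i \<in> e}))"

lemma even_degrees_sym_diff:
  assumes "finite A" "finite B" "even_degrees A" "even_degrees B"
  shows "even_degrees (sym_diff A B)"
  unfolding even_degrees_def
proof
  fix i
  have "{e \<in> sym_diff A B. i \<in> e} = sym_diff {e \<in> A. i \<in> e} {e \<in> B. i \<in> e}" by auto
  then show "even (card {e \<in> sym_diff A B. i \<in> e})"
    using assms by (simp add: even_card_sym_diff even_degrees_def)
qed

lemma even_degrees_clique: "\<lbrakk>finite X; odd (card X)\<rbrakk> \<Longrightarrow> even_degrees (clique X)"
  unfolding even_degrees_def by (simp add: even_card_clique_at)

text \<open>In a nonempty star with centre \<open>v\<close>, any leaf has degree 1.\<close>

lemma even_degrees_star_empty: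
  assumes E: "E \<subseteq> clique V" "even_degrees E" and star: "\<And>e. e \<in> E \<Longrightarrow> v \<in> e"
  shows "E = {}"
proof (rule ccontr)
  assume "E \<noteq> {}"
  then obtain e where e: "e \<in> E" by auto
  then have "card e = 2" "v \<in> e" using E star by (auto simp: clique_def)
  then obtain u where u: "e = {v, u}" "u \<noteq> v" by (auto simp: card_2_iff)
  have "{f \<in> E. u \<in> f} = {e}"
  proof (intro equalityI subsetI)
    fix f assume f: "f \<in> {f \<in> E. u \<in> f}"
    then have "card f = 2" "{v, u} \<subseteq> f" using E star by (auto simp: clique_def)
    then show "f \<in> {e}"
      using u by (metis card_2_iff card_subset_eq card.infinite singletonI zero_neq_numeral)
  qed (use e u in auto)
  then have "card {f \<in> E. u \<in> f} = 1" by simp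
  then show False using E(2) unfolding even_degrees_def by (metis odd_one)
qed

text \<open>Every edge avoiding \<open>v\<close> is cleared by adding the triangle it spans with
  \<open>v\<close>; what finally remains is a star, hence empty. All triangles are congruent to the
  one on \<open>t\<close>, so \<open>E\<close> is congruent to 0 or to that triangle. As a triangle
  has three edges, the parity of \<open>card E\<close> decides which.\<close>

lemma even_degrees_mod_triangle:
  assumes v: "v \<in> V" and E: "E \<subseteq> clique V" "even_degrees E" and t: "t \<subseteq> V" "card t = 3"
  shows "(if even (card E) then E else sym_diff E (clique t)) \<in> S"
  using E
proof (induction "card {e \<in> E. v \<notin> e}" arbitrary: E rule: less_induct)
  case less
  have fin: "finite E" using less.prems finite_clique[OF finite_V] finite_subset by blast
  show ?case
  proof (cases "\<exists>e\<in>E. v \<notin> e")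
    case False
    then have "E = {}" using less.prems even_degrees_star_empty by blast
    then show ?thesis using empty_in_S by simp
  next
    case True
    then obtain e where e: "e \<in> E" "v \<notin> e" by auto
    then have e2: "e \<subseteq> V" "card e = 2" using less.prems by (auto simp: clique_def)
    have fine: "finite e" using e2 finite_V finite_subset by blast
    let ?t = "insert v e"
    have t3: "?t \<subseteq> V" "finite ?t" "card ?t = 3" using e2 fine e v by auto
    let ?E = "sym_diff E (clique ?t)"
    \<comment> \<open>The only edge of the triangle that avoids \<open>v\<close> is
      \<open>e\<close>, so no new edge avoiding \<open>v\<close> appears and the measure
      drops.\<close>
    have "{f \<in> ?E. v \<notin> f} = {f \<in> E. v \<notin> f} - {e}"
    proof -
      have "{f \<in> clique ?t. v \<notin> f} = {e}"
        using e(2) clique_edge[OF e2(2)] by (auto simp: clique_def)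
      moreover have "{f \<in> ?E. v \<notin> f} = sym_diff {f \<in> E. v \<notin> f} {f \<in> clique ?t. v \<notin> f}"
        by blast
      moreover have "sym_diff A {e} = A - {e}" if "e \<in> A" for A
        using that by blast
      ultimately show ?thesis using e by simp
    qed
    also have "card \<dots> < card {f \<in> E. v \<notin> f}"
      using e fin by (intro card_Diff1_less) auto
    finally have smaller: "card {f \<in> ?E. v \<notin> f} < card {f \<in> E. v \<notin> f}" .
    have sub: "?E \<subseteq> clique V" using less.prems clique_mono[OF t3(1)] by auto
    have deg: "even_degrees ?E"
      using less.prems fin t3 by (intro even_degrees_sym_diff finite_clique even_degrees_clique) auto
    have IH: "(if even (card ?E) then ?E else sym_diff ?E (clique t)) \<in> S"
      by (rule less.hyps[OF smaller sub deg])
    have "odd (card (clique ?t))"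
      using t3 by (simp add: card_clique even_choose_two)
    then have par: "even (card ?E) \<longleftrightarrow> odd (card E)"
      using even_card_sym_diff[OF fin finite_clique[OF t3(2)]] by simp
    have cong: "sym_diff (clique ?t) (clique t) \<in> S"
      using t3 t by (intro triangles_congruent) auto
    show ?thesis
    proof (cases "even (card E)")
      case True
      then have "sym_diff ?E (clique t) \<in> S" using IH par by simp
      \<comment> \<open>Here \<open>?E\<close> has odd size, so the induction hypothesis adds the
        triangle on \<open>t\<close>; the congruence trades it for the one on \<open>?t\<close>,
        which cancels the triangle added to \<open>E\<close>.\<close>
      then have "sym_diff (sym_diff ?E (clique t)) (sym_diff (clique ?t) (clique t)) \<in> S"
        using cong by (rule sym_diff_in_S)
      also have "sym_diff (sym_diff ?E (clique t)) (sym_diff (clique ?t) (clique t)) = E"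
        by blast
      finally show ?thesis using True by simp
    next
      case False
      then have "?E \<in> S" using IH par by simp
      then show ?thesis using False sym_diff_trans_S[OF _ cong] by simp
    qed
  qed
qed

lemma even_degrees_even_size_in_S:
  assumes "E \<subseteq> clique V" "even_degrees E" "even (card E)"
  shows "E \<in> S"
proof -
  obtain t where t: "t \<subseteq> V" "card t = 3"
    using ex_superset_card[of "{}" "{}" 3] card_V p_ge_2 by auto
  then obtain v where "v \<in> t" by force
  then show ?thesis using even_degrees_mod_triangle[of v E t] t assms by auto
qed

section \<open>Characterisation of \<open>S\<close> by parities\<close>

text \<open>Both parity conditions are preserved by sums, so it suffices to check them on a
  \<open>p\<close>-clique. Finiteness is carried along because additivity of parity requires
  it.\<close>

lemma S_necessary:
  assumes "E \<in> S"
  shows "finite E \<and> (even (p choose 2) \<longrightarrow> even (card E)) \<and> (odd p \<longrightarrow> even_degrees E)"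
  using assms unfolding S_def
proof induction
  case empty
  then show ?case by (simp add: even_degrees_def)
next
  case (step g E)
  then obtain X where X: "X \<subseteq> V" "card X = p" "g = clique X" by auto
  then have fin: "finite X" using finite_V finite_subset by blast
  then show ?case
    using X step.IH
    by (auto simp: even_card_sym_diff finite_clique card_clique
        intro!: even_degrees_sym_diff even_degrees_clique)
qed

theorem in_S_iff:
  assumes E: "E \<subseteq> clique V"
  shows "E \<in> S \<longleftrightarrow> (even (p choose 2) \<longrightarrow> even (card E)) \<and> (odd p \<longrightarrow> even_degrees E)"
proof
  assume "E \<in> S"
  then show "(even (p choose 2) \<longrightarrow> even (card E)) \<and> (odd p \<longrightarrow> even_degrees E)"
    using S_necessary by blast
next
  assume cond: "(even (p choose 2) \<longrightarrow> even (card E)) \<and> (odd p \<longrightarrow> even_degrees E)"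
  have even_case: "F \<in> S" if "F \<subseteq> clique V" "even (card F)" "odd p \<longrightarrow> even_degrees F" for F
    using even_size_in_S even_degrees_even_size_in_S that by blast
  show "E \<in> S"
  proof (cases "even (card E)")
    case True
    then show ?thesis using even_case E cond by blast
  next
    case False
    obtain X where X: "X \<subseteq> V" "card X = p"
      using ex_superset_card[of "{}" "{}" p] card_V by auto
    have fin: "finite X" "finite E"
      using X E finite_V finite_clique[OF finite_V] finite_subset by blast+
    \<comment> \<open>With \<open>card E\<close> odd, the hypothesis forces
      \<open>p choose 2\<close> to be odd. Adding one \<open>p\<close>-clique thus makes the size
      even, and for odd \<open>p\<close> it keeps all degrees even.\<close>
    let ?F = "sym_diff E (clique X)"
    have "odd (card (clique X))" using cond False X fin by (auto simp: card_clique)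
    then have "even (card ?F)"
      using even_card_sym_diff[OF fin(2) finite_clique[OF fin(1)]] False by simp
    moreover have "odd p \<longrightarrow> even_degrees ?F"
      using cond X fin by (auto intro!: even_degrees_sym_diff finite_clique even_degrees_clique)
    moreover have "?F \<subseteq> clique V" using E clique_mono[OF X(1)] by auto
    ultimately have "?F \<in> S" by (intro even_case)
    then have "sym_diff ?F (clique X) \<in> S"
      using clique_in_S[OF X] by (rule sym_diff_in_S)
    also have "sym_diff ?F (clique X) = E" by blast
    finally show ?thesis .
  qed
qed

end

section \<open>Tournaments as edge sets\<close>

text \<open>Forgetting the direction loses nothing, since forward arcs run from the smaller to the
  larger endpoint; undirected edges make inversion a sum with a clique.\<close>

definition forward_edges :: "nat pair_pre_digraph \<Rightarrow> nat set set" where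
  "forward_edges T = (\<lambda>(i, j). {i, j}) ` forward_arcs T"

lemma inj_on_forward_arcs: "inj_on (\<lambda>(i, j). {i, j}) (forward_arcs T)"
  by (auto simp: inj_on_def forward_arcs_def doubleton_eq_iff)

lemma card_forward_edges: "card (forward_edges T) = card (forward_arcs T)"
  unfolding forward_edges_def by (rule card_image[OF inj_on_forward_arcs])

lemma card_forward_edges_at:
  "card {e \<in> forward_edges T. i \<in> e} = card (forward_arcs_at T i)"
proof -
  have "{e \<in> forward_edges T. i \<in> e} = (\<lambda>(i, j). {i, j}) ` forward_arcs_at T i"
    by (auto simp: forward_edges_def forward_arcs_at_def)
  moreover have "inj_on (\<lambda>(i, j). {i, j}) (forward_arcs_at T i)"
    by (rule inj_on_subset[OF inj_on_forward_arcs]) (auto simp: forward_arcs_at_def)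
  ultimately show ?thesis by (simp add: card_image)
qed

lemma in_forward_edges_iff:
  "i < j \<Longrightarrow> {i, j} \<in> forward_edges T \<longleftrightarrow> (i, j) \<in> parcs T"
  by (force simp: forward_edges_def forward_arcs_def doubleton_eq_iff)

lemma (in tournament) arc_reverse_iff:
  "\<lbrakk>u \<in> pverts G; v \<in> pverts G; u \<noteq> v\<rbrakk> \<Longrightarrow> (v, u) \<in> parcs G \<longleftrightarrow> (u, v) \<notin> parcs G"
  using arc_between no_opposite_arcs by blast

lemma (in tournament) arc_vertsD:
  "(u, v) \<in> parcs G \<Longrightarrow> u \<in> pverts G \<and> v \<in> pverts G \<and> u \<noteq> v"
  using arc_fst_in_verts arc_snd_in_verts pair_no_loops by fastforce

lemma forward_edges_subset_clique:
  assumes "tournament T"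
  shows "forward_edges T \<subseteq> clique (pverts T)"
  using tournament.arc_vertsD[OF assms]
  by (auto simp: forward_edges_def forward_arcs_def clique_alt)

lemma tournament_inversion:
  assumes "tournament T"
  shows "tournament (inversion T X)"
proof -
  interpret tournament T by (rule assms)
  show ?thesis
  proof unfold_locales
    have "parcs (inversion T X) \<subseteq> pverts T \<times> pverts T"
      using arc_vertsD by (auto simp: in_parcs_inversion_iff split: if_splits)
    then show "finite (parcs (inversion T X))"
      using pair_finite_verts finite_subset by blast
  qed (use pair_finite_verts arc_vertsD no_opposite_arcs arc_between in
      \<open>fastforce simp: in_parcs_inversion_iff split: if_splits\<close>)+
qed

lemma tournament_Inv: "tournament T \<Longrightarrow> tournament (Inv T Xs)"
  unfolding Inv_def by (induction Xs arbitrary: T) (simp_all add: tournament_inversion)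

lemma subset_clique_eqI:
  fixes V :: "nat set"
  assumes "A \<subseteq> clique V" "B \<subseteq> clique V"
    and "\<And>i j. \<lbrakk>i \<in> V; j \<in> V; i < j\<rbrakk> \<Longrightarrow> {i, j} \<in> A \<longleftrightarrow> {i, j} \<in> B"
  shows "A = B"
proof -
  have "e \<in> A \<longleftrightarrow> e \<in> B" if e: "e \<in> clique V" for e
  proof -
    obtain i j where ij: "i \<in> V" "j \<in> V" "i \<noteq> j" "e = {i, j}"
      using e unfolding clique_alt by blast
    then show ?thesis
      using assms(3)[of i j] assms(3)[of j i]
      by (cases i j rule: linorder_cases) (simp_all add: insert_commute)
  qed
  then show ?thesis using assms(1,2) by blast
qed

text \<open>For a pair inside \<open>X\<close>, inversion swaps its two possible arcs, and a
  tournament contains exactly one of them; so the pair becomes forward exactly if it was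
  not.\<close>

lemma forward_edges_inversion:
  assumes "tournament T" "X \<subseteq> pverts T"
  shows "forward_edges (inversion T X) = sym_diff (forward_edges T) (clique X)"
proof (rule subset_clique_eqI)
  show "forward_edges (inversion T X) \<subseteq> clique (pverts T)"
    using forward_edges_subset_clique[OF tournament_inversion[OF assms(1)]] by simp
  show "sym_diff (forward_edges T) (clique X) \<subseteq> clique (pverts T)"
    using forward_edges_subset_clique[OF assms(1)] clique_mono[OF assms(2)] by blast
  fix i j assume ij: "i \<in> pverts T" "j \<in> pverts T" "i < j"
  then have "{i, j} \<in> clique X \<longleftrightarrow> i \<in> X \<and> j \<in> X"
    by (auto simp: clique_def)
  then show "{i, j} \<in> forward_edges (inversion T X) \<longleftrightarrow>
      {i, j} \<in> sym_diff (forward_edges T) (clique X)"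
    using ij tournament.arc_reverse_iff[OF assms(1), of i j]
    by (auto simp: in_forward_edges_iff in_parcs_inversion_iff)
qed

text \<open>Backward arcs are determined by the forward ones, as exactly one of the two arcs on each
  pair is present.\<close>

lemma tournament_eqI:
  assumes T: "tournament T" and T': "tournament T'" and "pverts T = pverts T'"
    and eq: "forward_edges T = forward_edges T'"
  shows "T = T'"
proof -
  have fwd: "(i, j) \<in> parcs T \<longleftrightarrow> (i, j) \<in> parcs T'" if "i < j" for i j
    using eq in_forward_edges_iff[OF that] by metis
  have "(u, v) \<in> parcs T \<longleftrightarrow> (u, v) \<in> parcs T'" for u v
  proof (cases "u \<in> pverts T \<and> v \<in> pverts T \<and> u \<noteq> v")
    case True
    then show ?thesis
      using fwd tournament.arc_reverse_iff[OF T, of u v] tournament.arc_reverse_iff[OF T', of u v]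
        assms(3) by (cases u v rule: linorder_cases) auto
  next
    case False
    then show ?thesis
      using tournament.arc_vertsD[OF T] tournament.arc_vertsD[OF T'] assms(3) by metis
  qed
  then have "parcs T = parcs T'" by auto
  then show ?thesis using assms(3) by simp
qed

section \<open>Sequences of inversions as elements of the span\<close>

lemma forward_edges_Inv_in_xor_span:
  assumes "tournament T" "\<forall>X\<in>set Xs. X \<subseteq> pverts T \<and> card X = p"
  shows "sym_diff (forward_edges T) (forward_edges (Inv T Xs))
    \<in> xor_span (clique ` {X. X \<subseteq> pverts T \<and> card X = p})"
  using assms
proof (induction Xs arbitrary: T)
  case Nil
  then show ?case by (simp add: Inv_def xor_span.empty)
next
  case (Cons X Xs)
  have "Inv T (X # Xs) = Inv (inversion T X) Xs" by (simp add: Inv_def)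
  moreover have "sym_diff (forward_edges (inversion T X)) (forward_edges (Inv (inversion T X) Xs))
      \<in> xor_span (clique ` {X. X \<subseteq> pverts T \<and> card X = p})"
    using Cons.IH[of "inversion T X"] Cons.prems by (simp add: tournament_inversion)
  moreover have "sym_diff (forward_edges T) (forward_edges (inversion T X))
      \<in> xor_span (clique ` {X. X \<subseteq> pverts T \<and> card X = p})"
  proof -
    have "sym_diff (forward_edges T) (forward_edges (inversion T X)) = clique X"
      using forward_edges_inversion[of T X] Cons.prems by auto
    then show ?thesis using Cons.prems by (auto intro: xor_span_base)
  qed
  ultimately show ?case using xor_span_sym_diff_trans by simp
qed

text \<open>Each generator used in the span becomes one further inversion. \<open>T\<close> stays
  fixed in the induction, so the new set is appended at the end of the list.\<close>

lemma xor_span_realised_by_Inv: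
  assumes "E \<in> xor_span (clique ` {X. X \<subseteq> pverts T \<and> card X = p})" "tournament T"
  shows "\<exists>Xs. (\<forall>X\<in>set Xs. X \<subseteq> pverts T \<and> card X = p) \<and>
    forward_edges (Inv T Xs) = sym_diff (forward_edges T) E"
  using assms(1)
proof induction
  case empty
  show ?case by (rule exI[of _ "[]"]) (simp add: Inv_def)
next
  case (step g E)
  then obtain X Xs where X: "X \<subseteq> pverts T" "card X = p" "g = clique X"
    and Xs: "\<forall>X\<in>set Xs. X \<subseteq> pverts T \<and> card X = p"
      "forward_edges (Inv T Xs) = sym_diff (forward_edges T) E" by auto
  have "Inv T (Xs @ [X]) = inversion (Inv T Xs) X" by (simp add: Inv_def)
  then have "forward_edges (Inv T (Xs @ [X])) = sym_diff (sym_diff (forward_edges T) E) g"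
    using forward_edges_inversion[OF tournament_Inv[OF assms(2)], of X Xs] X Xs by simp
  also have "\<dots> = sym_diff (forward_edges T) (sym_diff g E)" by blast
  finally show ?case using X Xs by (intro exI[of _ "Xs @ [X]"]) auto
qed

lemma Inv_iff_in_xor_span:
  assumes "tournament T1" "tournament T2" "pverts T1 = V" "pverts T2 = V"
  shows "(\<exists>Xs. (\<forall>X\<in>set Xs. X \<subseteq> V \<and> card X = p) \<and> T2 = Inv T1 Xs) \<longleftrightarrow>
    sym_diff (forward_edges T1) (forward_edges T2) \<in> xor_span (clique ` {X. X \<subseteq> V \<and> card X = p})"
    (is "?L \<longleftrightarrow> ?R")
proof
  assume ?L
  then show ?R using forward_edges_Inv_in_xor_span[of T1 _ p] assms by auto
next
  assume ?R
  then obtain Xs where Xs: "\<forall>X\<in>set Xs. X \<subseteq> V \<and> card X = p"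
    "forward_edges (Inv T1 Xs)
      = sym_diff (forward_edges T1) (sym_diff (forward_edges T1) (forward_edges T2))"
    using xor_span_realised_by_Inv[of _ T1 p] assms by blast
  then have "forward_edges T2 = forward_edges (Inv T1 Xs)" by blast
  then have "T2 = Inv T1 Xs"
    using assms by (intro tournament_eqI tournament_Inv) auto
  then show ?L using Xs by blast
qed

section \<open>Handshake lemma and the last vertex\<close>

text \<open>Double counting of incident pairs of a vertex and an edge.\<close>

lemma sum_degrees:
  assumes "finite V" "E \<subseteq> clique V"
  shows "(\<Sum>i\<in>V. card {e \<in> E. i \<in> e}) = 2 * card E"
proof -
  have fin: "finite E" using assms finite_clique finite_subset by blast
  have "(\<Sum>i\<in>V. card {e \<in> E. i \<in> e}) = (\<Sum>i\<in>V. \<Sum>e\<in>E. if i \<in> e then 1 else 0)"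
    using fin by (simp add: sum.If_cases Int_def)
  also have "\<dots> = (\<Sum>e\<in>E. \<Sum>i\<in>V. if i \<in> e then 1 else 0)" by (rule sum.swap)
  also have "\<dots> = (\<Sum>e\<in>E. 2)"
  proof (rule sum.cong[OF refl])
    fix e assume "e \<in> E"
    then have "V \<inter> e = e" "card e = 2" using assms by (auto simp: clique_def)
    then show "(\<Sum>i\<in>V. if i \<in> e then 1 else 0) = (2::nat)"
      using assms(1) by (simp add: sum.If_cases)
  qed
  finally show ?thesis by simp
qed

text \<open>The degree sum is even, so the parities of all degrees but one determine the last. This
  explains why the theorem only mentions the vertices up to \<open>n - 1\<close>.\<close>

lemma even_degree_last:
  assumes "finite V" "E \<subseteq> clique V" "v \<in> V"
    and "\<forall>i\<in>V - {v}. even (card {e \<in> E. i \<in> e})"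
  shows "even (card {e \<in> E. v \<in> e})"
proof -
  have "card {e \<in> E. v \<in> e} + (\<Sum>i\<in>V - {v}. card {e \<in> E. i \<in> e}) = 2 * card E"
    using sum_degrees[OF assms(1,2)] sum.remove[OF assms(1,3)] by metis
  moreover have "even (\<Sum>i\<in>V - {v}. card {e \<in> E. i \<in> e})"
    using assms(4) by (intro dvd_sum) auto
  moreover have "even x" if "x + y = 2 * c" "even y" for x y c :: nat
    using that by presburger
  ultimately show ?thesis by blast
qed

theorem theorem1p1:
  fixes n p :: nat and T1 T2 :: "nat pair_pre_digraph"
  assumes "p \<ge> 2" and "n \<ge> p + 2"
    and "tournament T1" and "pverts T1 = {1..n}"
    and "tournament T2" and "pverts T2 = {1..n}"
  shows "(\<exists>Xs :: nat set list.
            (\<forall>X \<in> set Xs. X \<subseteq> {1..n} \<and> card X = p) \<and> T2 = Inv T1 Xs) \<longleftrightarrow>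
    ([p = 0] (mod 4) \<and> [card (forward_arcs T1) = card (forward_arcs T2)] (mod 2)) \<or>
    ([p = 1] (mod 4) \<and>
       (\<forall>i \<in> {1..n - 1}.
          [card (forward_arcs_at T1 i) = card (forward_arcs_at T2 i)] (mod 2)) \<and>
       [card (forward_arcs T1) = card (forward_arcs T2)] (mod 2)) \<or>
    [p = 2] (mod 4) \<or>
    ([p = 3] (mod 4) \<and>
       (\<forall>i \<in> {1..n - 1}.
          [card (forward_arcs_at T1 i) = card (forward_arcs_at T2 i)] (mod 2)))"
proof -
  interpret clique_span "{1..n}" p
    using assms by unfold_locales auto
  define E where "E = sym_diff (forward_edges T1) (forward_edges T2)"
  have sub: "forward_edges T1 \<subseteq> clique {1..n}" "forward_edges T2 \<subseteq> clique {1..n}"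
    using assms forward_edges_subset_clique by metis+
  then have fin: "finite (forward_edges T1)" "finite (forward_edges T2)"
    using finite_clique[of "{1..n}"] finite_subset by blast+
  have E: "E \<subseteq> clique {1..n}" using sub unfolding E_def by blast
  have cong2: "[a = b] (mod 2) \<longleftrightarrow> (even a \<longleftrightarrow> even b)" for a b :: nat
    unfolding cong_def by presburger
  have size: "even (card E) \<longleftrightarrow> [card (forward_arcs T1) = card (forward_arcs T2)] (mod 2)"
    unfolding E_def cong2 using even_card_sym_diff[OF fin] by (simp add: card_forward_edges)
  have deg: "even (card {e \<in> E. i \<in> e}) \<longleftrightarrow>
      [card (forward_arcs_at T1 i) = card (forward_arcs_at T2 i)] (mod 2)" for i
  proof -
    have "{e \<in> E. i \<in> e} = sym_diff {e \<in> forward_edges T1. i \<in> e} {e \<in> forward_edges T2. i \<in> e}"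
      unfolding E_def by auto
    then show ?thesis
      using fin by (simp add: cong2 even_card_sym_diff card_forward_edges_at)
  qed
  have degs: "even_degrees E \<longleftrightarrow> (\<forall>i \<in> {1..n - 1}.
      [card (forward_arcs_at T1 i) = card (forward_arcs_at T2 i)] (mod 2))"
  proof
    assume "even_degrees E"
    then show "\<forall>i \<in> {1..n - 1}. [card (forward_arcs_at T1 i) = card (forward_arcs_at T2 i)] (mod 2)"
      using deg by (auto simp: even_degrees_def)
  next
    assume "\<forall>i \<in> {1..n - 1}. [card (forward_arcs_at T1 i) = card (forward_arcs_at T2 i)] (mod 2)"
    then have *: "\<forall>i\<in>{1..n} - {n}. even (card {e \<in> E. i \<in> e})"
      using deg by auto
    have "even (card {e \<in> E. n \<in> e})"
      using assms by (intro even_degree_last[OF _ E _ *]) auto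
    moreover have "{e \<in> E. i \<in> e} = {}" if "i \<notin> {1..n}" for i
      using E that unfolding clique_def by blast
    ultimately show "even_degrees E"
      unfolding even_degrees_def using * by (metis Diff_iff card.empty even_zero singletonD)
  qed
  have "p mod 4 < 4" by simp
  then have mod4: "p mod 4 = 0 \<or> p mod 4 = 1 \<or> p mod 4 = 2 \<or> p mod 4 = 3" by linarith
  have odd: "odd p \<longleftrightarrow> p mod 4 = 1 \<or> p mod 4 = 3" by presburger
  have "(\<exists>Xs. (\<forall>X \<in> set Xs. X \<subseteq> {1..n} \<and> card X = p) \<and> T2 = Inv T1 Xs) \<longleftrightarrow> E \<in> S"
    using Inv_iff_in_xor_span[OF assms(3,5,4,6), of p] unfolding E_def S_def .
  \<comment> \<open>The size condition applies for residues 0 and 1, the degree condition for 1 and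
    3. Residue 2 carries no condition, and splitting by residue yields the four cases.\<close>
  also have "\<dots> \<longleftrightarrow> (p mod 4 = 0 \<or> p mod 4 = 1 \<longrightarrow> even (card E)) \<and>
      (p mod 4 = 1 \<or> p mod 4 = 3 \<longrightarrow> even_degrees E)"
    unfolding in_S_iff[OF E] even_choose_two odd ..
  finally show ?thesis
    unfolding size degs cong_def[of p] using mod4 by (elim disjE) (simp_all add: conj_commute)
qed

end
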